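(* Let $A$ be an $n\times m$ complex matrix, $X$ an $n\times p$ complex matrix, $Y$ an $m\times q$ complex matrix, and let $$M = A^{\dagger} - A^{\dagger} X (Y^{*} A^{\dagger} X)^{\dagger} Y^{*} A^{\dagger}.$$ Put $\hat{\mathcal X}=\ker(M)\subseteq\mathbb C^n$ and $\hat{\mathcal Y}=\operatorname{im}(M)^{\perp}\subseteq\mathbb C^m$. Then $M$ is the outer inverse of $A$ with image $\hat{\mathcal Y}^{\perp}$ and kernel $\hat{\mathcal X}$, that is, $M=A^{(2)}_{\hat{\mathcal Y}^{\perp},\hat{\mathcal X}}$. Furthermore, $\dim(\hat{\mathcal Y})+\operatorname{rank}(A)\ge m$.
   Context: $(\cdot)^{\dagger}$ is the Moore-Penrose pseudo-inverse, $(\cdot)^{*}$ the conjugate transpose, $(\cdot)^{\perp}$ the orthogonal complement. An outer inverse (or $\{2\}$-inverse) of $A$ is a matrix $Z$ with $ZAZ=Z$. For subspaces $\mathcal R\subseteq\mathbb C^m$, $\mathcal N\subseteq\mathbb C^n$, $A^{(2)}_{\mathcal R,\mathcal N}$ denotes the outer inverse of $A$ with image $\mathcal R$ and kernel $\mathcal N$; it is unique when it exists, and it exists if and only if $A\mathcal R\oplus\mathcal N=\mathbb C^n$ (with $\dim A\mathcal R=\dim\mathcal R$). *)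

theory Defs
  imports "HOL-Analysis.Analysis"
begin

(* An n x m matrix is a term of type complex^'m^'n and acts by ( *v) from C^m to C^n. *)

definition conj_transpose :: "complex^'m^'n \<Rightarrow> complex^'n^'m" where
  "conj_transpose A = (\<chi> i j. cnj (A $ j $ i))"

(* The library's inner product on complex^'n is the real-valued one, hence this definition. *)
definition hinner :: "complex^'n \<Rightarrow> complex^'n \<Rightarrow> complex" where
  "hinner x y = (\<Sum>i\<in>UNIV. x $ i * cnj (y $ i))"

definition orth_compl :: "(complex^'n) set \<Rightarrow> (complex^'n) set" where
  "orth_compl S = {x. \<forall>y\<in>S. hinner x y = 0}"

definition mat_image :: "complex^'m^'n \<Rightarrow> (complex^'n) set" where
  "mat_image A = range (\<lambda>x. A *v x)"

definition mat_ker :: "complex^'m^'n \<Rightarrow> (complex^'m) set" where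
  "mat_ker A = {x. A *v x = 0}"

(* The four Penrose equations, which determine P uniquely. *)
definition is_mp_inverse :: "complex^'m^'n \<Rightarrow> complex^'n^'m \<Rightarrow> bool" where
  "is_mp_inverse A P \<longleftrightarrow>
     A ** P ** A = A \<and> P ** A ** P = P \<and>
     conj_transpose (A ** P) = A ** P \<and> conj_transpose (P ** A) = P ** A"

definition mp_inverse :: "complex^'m^'n \<Rightarrow> complex^'n^'m" where
  "mp_inverse A = (THE P. is_mp_inverse A P)"

definition is_outer_inverse :: "complex^'m^'n \<Rightarrow> complex^'n^'m \<Rightarrow> bool" where
  "is_outer_inverse A Z \<longleftrightarrow> Z ** A ** Z = Z"

definition is_outer_inverse_with ::
    "complex^'m^'n \<Rightarrow> (complex^'m) set \<Rightarrow> (complex^'n) set \<Rightarrow> complex^'n^'m \<Rightarrow> bool" where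
  "is_outer_inverse_with A R N Z \<longleftrightarrow>
     is_outer_inverse A Z \<and> mat_image Z = R \<and> mat_ker Z = N"

(* Unspecified when no outer inverse with image R and kernel N exists; use it together
   with is_outer_inverse_with. *)
definition outer_inverse_with ::
    "complex^'m^'n \<Rightarrow> (complex^'m) set \<Rightarrow> (complex^'n) set \<Rightarrow> complex^'n^'m" where
  "outer_inverse_with A R N = (THE Z. is_outer_inverse_with A R N Z)"

end

theory Submission
  imports Defs
begin

text \<open>
  Writing \<open>P\<close> for the Moore--Penrose inverse of \<open>A\<close> and \<open>S\<close> for that of \<open>W = Y\<^sup>* P X\<close>, the matrix
  \<open>U = P X S Y\<^sup>* P\<close> satisfies \<open>P A U = U = U A P\<close> and, as \<open>S W S = S\<close>, also \<open>U A U = U\<close>;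
  hence \<open>M = P - U\<close> satisfies \<open>M A M = M\<close>. The orthogonal projector \<open>M M\<^sup>\<dagger>\<close> onto the image of \<open>M\<close>
  identifies the image with its double orthogonal complement. Finally \<open>M A M = M\<close> forces the image
  of \<open>M\<close> to meet the kernel of \<open>A\<close> trivially, so its dimension is at most the rank of \<open>A\<close>.
\<close>

section \<open>Conjugate transpose and Hermitian inner product\<close>

lemma conj_transpose_mult:
  "conj_transpose (A ** B) = conj_transpose B ** conj_transpose A"
  by (simp add: conj_transpose_def matrix_matrix_mult_def vec_eq_iff mult.commute)

lemma conj_transpose_conj_transpose [simp]: "conj_transpose (conj_transpose A) = A"
  by (simp add: conj_transpose_def vec_eq_iff)

lemma conj_transpose_diff:
  "conj_transpose (A - B) = conj_transpose A - conj_transpose B"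
  by (simp add: conj_transpose_def vec_eq_iff)

lemma conj_transpose_zero [simp]: "conj_transpose 0 = 0"
  by (simp add: conj_transpose_def vec_eq_iff)

lemma hinner_diff_left: "hinner (x - y) z = hinner x z - hinner y z"
  by (simp add: hinner_def left_diff_distrib sum_subtractf)

lemma hinner_commute: "hinner x y = cnj (hinner y x)"
  by (simp add: hinner_def mult.commute)

lemma hinner_self_eq_0 [simp]: "hinner x x = 0 \<longleftrightarrow> x = 0"
proof
  have "hinner x x = complex_of_real (\<Sum>i\<in>UNIV. (cmod (x $ i))\<^sup>2)"
    unfolding hinner_def of_real_sum by (simp only: complex_norm_square)
  moreover assume "hinner x x = 0"
  ultimately have "(\<Sum>i\<in>UNIV. (cmod (x $ i))\<^sup>2) = 0"
    by (metis of_real_eq_0_iff)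
  then show "x = 0"
    by (simp add: sum_nonneg_eq_0_iff vec_eq_iff)
qed (simp add: hinner_def)

lemma hinner_matrix_vector_mult:
  "hinner (A *v x) y = hinner x (conj_transpose A *v y)"
proof -
  have "hinner (A *v x) y = (\<Sum>i\<in>UNIV. \<Sum>j\<in>UNIV. A $ i $ j * x $ j * cnj (y $ i))"
    by (simp add: hinner_def matrix_vector_mult_def sum_distrib_right)
  also have "\<dots> = (\<Sum>j\<in>UNIV. \<Sum>i\<in>UNIV. A $ i $ j * x $ j * cnj (y $ i))"
    by (rule sum.swap)
  also have "\<dots> = hinner x (conj_transpose A *v y)"
    by (simp add: hinner_def matrix_vector_mult_def conj_transpose_def sum_distrib_left ac_simps)
  finally show ?thesis .
qed

lemma matrix_diff_ldistrib: "A ** (B - C) = A ** B - A ** C"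
  for A :: "'a::ring_1^'n^'m"
  by (simp add: matrix_matrix_mult_def vec_eq_iff right_diff_distrib sum_subtractf)

lemma matrix_diff_rdistrib: "(A - B) ** C = A ** C - B ** C"
  for A :: "'a::ring_1^'n^'m"
  by (simp add: matrix_matrix_mult_def vec_eq_iff left_diff_distrib sum_subtractf)

text \<open>By adjointness \<open>hinner (D *v x) (D *v x)\<close> equals \<open>hinner x 0\<close>,
  so definiteness kills every \<open>D *v x\<close>.\<close>

lemma conj_transpose_mult_self_eq_0:
  assumes "conj_transpose D ** D = 0"
  shows "D = 0"
proof -
  have "D *v x = 0" for x
  proof -
    have "hinner (D *v x) (D *v x) = hinner x ((conj_transpose D ** D) *v x)"
      by (simp add: hinner_matrix_vector_mult matrix_vector_mul_assoc)
    also have "\<dots> = 0"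
      by (simp add: assms hinner_def)
    finally show ?thesis by simp
  qed
  then show ?thesis by (simp add: matrix_eq)
qed

section \<open>Moore-Penrose inverse: existence and uniqueness\<close>

lemma inner_inverse_exists:
  fixes A :: "'a::field^'m^'n"
  obtains G :: "'a^'n^'m" where "A ** G ** A = A"
proof -
  \<comment> \<open>A linear \<open>g\<close> that inverts \<open>A\<close> on its range satisfies
    \<open>A (g (A x)) = A x\<close>; its matrix is the witness.\<close>
  obtain g :: "'a^'n \<Rightarrow> 'a^'m" where g: "Vector_Spaces.linear (*s) (*s) g"
      "\<forall>v\<in>range ((*v) A). A *v g v = v"
    using vec.linear_exists_right_inverse_on[OF matrix_vector_mul_linear_gen vec.subspace_UNIV, of A]
    by blast
  have "A ** matrix g ** A = A"
    using g by (simp add: matrix_eq matrix_vector_mul_assoc[symmetric] matrix_works)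
  then show ?thesis by (rule that)
qed

text \<open>Least squares through the normal equations: \<open>K\<close> is built from any inner
  inverse of the possibly singular \<open>A\<^sup>* A\<close>.\<close>

lemma inner_inverse_hermitian_exists:
  fixes A :: "complex^'m^'n"
  obtains K :: "complex^'n^'m"
    where "A ** K ** A = A" "conj_transpose (A ** K) = A ** K"
proof -
  let ?B = "conj_transpose A ** A"
  obtain G where G: "?B ** G ** ?B = ?B"
    using inner_inverse_exists by blast
  define K where "K = G ** conj_transpose A"
  let ?D = "A ** K ** A - A"
  have "conj_transpose A ** ?D = 0"
    using G by (simp add: K_def matrix_diff_ldistrib matrix_mul_assoc)
  \<comment> \<open>The adjoint of \<open>?D\<close> ends in the factor \<open>A\<^sup>*\<close>,
    which annihilates \<open>?D\<close>.\<close>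
  moreover have "conj_transpose ?D = (conj_transpose (K ** A) - mat 1) ** conj_transpose A"
    by (simp add: conj_transpose_diff conj_transpose_mult matrix_diff_rdistrib matrix_mul_assoc)
  ultimately have "conj_transpose ?D ** ?D = 0"
    by (simp add: matrix_mul_assoc[symmetric])
  then have 1: "A ** K ** A = A"
    using conj_transpose_mult_self_eq_0 by fastforce
  \<comment> \<open>\<open>A K = A G A\<^sup>* = (A K) (A K)\<^sup>*\<close>, since \<open>A\<^sup>* = (A K A)\<^sup>* = A\<^sup>* (A K)\<^sup>*\<close>\<close>
  have "conj_transpose A = conj_transpose A ** conj_transpose (A ** K)"
    using arg_cong[OF 1, of conj_transpose] by (simp add: conj_transpose_mult)
  then have "A ** K = (A ** K) ** conj_transpose (A ** K)"
    unfolding K_def by (metis matrix_mul_assoc)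
  then have "conj_transpose (A ** K) = A ** K"
    by (metis conj_transpose_mult conj_transpose_conj_transpose)
  with 1 show ?thesis by (rule that)
qed

lemma is_mp_inverse_exists: "\<exists>P. is_mp_inverse A P"
proof -
  obtain K where K: "A ** K ** A = A" "conj_transpose (A ** K) = A ** K"
    using inner_inverse_hermitian_exists by blast
  obtain L where L: "conj_transpose A ** L ** conj_transpose A = conj_transpose A"
      "conj_transpose (conj_transpose A ** L) = conj_transpose A ** L"
    using inner_inverse_hermitian_exists by blast
  \<comment> \<open>Passing to the adjoint turns \<open>L\<close>, with \<open>A\<^sup>* L\<close>
    Hermitian, into an inner inverse \<open>H\<close> of \<open>A\<close> with \<open>H A\<close>
    Hermitian.\<close>
  define H where "H = conj_transpose L"
  have H: "A ** H ** A = A" "conj_transpose (H ** A) = H ** A"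
    using arg_cong[OF L(1), of conj_transpose] L(2)
    by (simp_all add: H_def conj_transpose_mult matrix_mul_assoc)
  \<comment> \<open>\<open>H A K\<close> inherits the Hermitian product \<open>A K\<close> from
    \<open>K\<close> and \<open>H A\<close> from \<open>H\<close>.\<close>
  have AP: "A ** (H ** A ** K) = A ** K" and PA: "(H ** A ** K) ** A = H ** A"
    using H(1) K(1) by (metis matrix_mul_assoc)+
  have "A ** (H ** A ** K) ** A = A" "(H ** A ** K) ** A ** (H ** A ** K) = H ** A ** K"
    using AP PA H(1) K(1) by (metis matrix_mul_assoc)+
  then have "is_mp_inverse A (H ** A ** K)"
    unfolding is_mp_inverse_def AP PA using H(2) K(2) by blast
  then show ?thesis ..
qed

text \<open>\<open>A P\<close> and \<open>A Q\<close> are Hermitian projectors with the same image,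
  hence equal; likewise \<open>P A\<close> and \<open>Q A\<close>, with the same kernel. Then
  \<open>P = P A P = Q A P = Q A Q = Q\<close>.\<close>

lemma is_mp_inverse_unique:
  assumes "is_mp_inverse A P" "is_mp_inverse A Q"
  shows "P = Q"
proof -
  note P = assms(1)[unfolded is_mp_inverse_def] and Q = assms(2)[unfolded is_mp_inverse_def]
  have "A ** P = (A ** Q) ** (A ** P)"
    using Q by (simp add: matrix_mul_assoc)
  also have "\<dots> = conj_transpose ((A ** P) ** (A ** Q))"
    using P Q by (simp add: conj_transpose_mult)
  also have "\<dots> = A ** Q"
    using P Q by (simp add: matrix_mul_assoc)
  finally have AP: "A ** P = A ** Q" .
  have "P ** A = (P ** A) ** (Q ** A)"
    using Q by (metis matrix_mul_assoc)
  also have "\<dots> = conj_transpose ((Q ** A) ** (P ** A))"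
    using P Q by (simp add: conj_transpose_mult)
  also have "\<dots> = Q ** A"
    using P Q by (metis matrix_mul_assoc)
  finally have PA: "P ** A = Q ** A" .
  show ?thesis
    using P Q AP PA by (metis matrix_mul_assoc)
qed

lemma is_mp_inverse_mp_inverse: "is_mp_inverse A (mp_inverse A)"
  unfolding mp_inverse_def
  using is_mp_inverse_exists is_mp_inverse_unique by (metis theI)

lemma
  fixes A :: "complex^'m^'n"
  shows inner_mp_inverse: "A ** mp_inverse A ** A = A"
    and outer_mp_inverse: "mp_inverse A ** A ** mp_inverse A = mp_inverse A"
    and hermitian_mult_mp_inverse: "conj_transpose (A ** mp_inverse A) = A ** mp_inverse A"
  using is_mp_inverse_mp_inverse[of A] by (simp_all add: is_mp_inverse_def)

section \<open>Outer inverses: the deflated matrix and uniqueness\<close>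

lemma outer_inverse_deflation:
  fixes A :: "'a::ring_1^'m^'n"
  assumes P: "P ** A ** P = P" and S: "S ** (V ** P ** X) ** S = S"
  defines "M \<equiv> P - P ** X ** S ** V ** P"
  shows "M ** A ** M = M"
proof -
  let ?U = "P ** X ** S ** V ** P"
  have "P ** A ** ?U = ?U"
    by (simp add: matrix_mul_assoc P)
  moreover have "?U ** A ** P = ?U"
    by (metis matrix_mul_assoc P)
  moreover have "?U ** A ** ?U = ?U"
  proof -
    have "?U ** A ** ?U = P ** X ** S ** V ** (P ** A ** P) ** X ** S ** V ** P"
      by (simp add: matrix_mul_assoc)
    also have "\<dots> = P ** X ** (S ** (V ** P ** X) ** S) ** V ** P"
      unfolding P by (simp add: matrix_mul_assoc)
    finally show ?thesis unfolding S .
  qed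
  \<comment> \<open>Expanding \<open>M A M\<close> leaves \<open>P - U - U + U\<close>.\<close>
  ultimately show ?thesis
    by (simp add: M_def matrix_diff_ldistrib matrix_diff_rdistrib P)
qed

lemma is_outer_inverse_with_unique:
  assumes Z: "is_outer_inverse_with A R N Z" and W: "is_outer_inverse_with A R N W"
  shows "Z = W"
proof -
  have "Z ** A ** Z = Z" "W ** A ** W = W"
    using Z W by (simp_all add: is_outer_inverse_with_def is_outer_inverse_def)
  \<comment> \<open>\<open>Z A\<close> fixes the image of \<open>Z\<close>, which is that of \<open>W\<close>; \<open>A W\<close> fixes everything modulo the kernel of
    \<open>W\<close>, which is that of \<open>Z\<close>.\<close>
  have "(Z ** A ** W) *v x = W *v x" for x
  proof -
    have "W *v x \<in> mat_image Z"
      using Z W by (auto simp: is_outer_inverse_with_def mat_image_def)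
    then obtain y where "W *v x = Z *v y"
      by (auto simp: mat_image_def)
    then show ?thesis
      using \<open>Z ** A ** Z = Z\<close> by (metis matrix_vector_mul_assoc)
  qed
  moreover have "(Z ** A ** W) *v x = Z *v x" for x
  proof -
    have "W *v ((A ** W) *v x - x) = 0"
      using \<open>W ** A ** W = W\<close>
      by (simp add: matrix_vector_mult_diff_distrib matrix_vector_mul_assoc matrix_mul_assoc)
    then have "Z *v ((A ** W) *v x - x) = 0"
      using Z W by (auto simp: is_outer_inverse_with_def mat_ker_def)
    then show ?thesis
      by (simp add: matrix_vector_mult_diff_distrib matrix_vector_mul_assoc matrix_mul_assoc)
  qed
  ultimately show ?thesis by (simp add: matrix_eq)
qed

lemma outer_inverse_with_eq:
  assumes "is_outer_inverse_with A R N Z"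
  shows "outer_inverse_with A R N = Z"
  unfolding outer_inverse_with_def
  using assms is_outer_inverse_with_unique by blast

section \<open>Orthogonal projection onto an image\<close>

lemma diff_projection_in_orth_compl:
  "x - (M ** mp_inverse M) *v x \<in> orth_compl (mat_image M)"
proof -
  let ?Q = "M ** mp_inverse M"
  \<comment> \<open>\<open>?Q\<close> is Hermitian, so it moves to the other argument, where it
    fixes \<open>M *v z\<close>.\<close>
  have "hinner (x - ?Q *v x) (M *v z) = 0" for z
  proof -
    have "hinner (x - ?Q *v x) (M *v z) = hinner x (M *v z) - hinner x (?Q *v (M *v z))"
      by (simp add: hinner_diff_left hinner_matrix_vector_mult[of ?Q] hermitian_mult_mp_inverse)
    then show ?thesis
      by (simp add: matrix_vector_mul_assoc inner_mp_inverse)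
  qed
  then show ?thesis by (auto simp: orth_compl_def mat_image_def)
qed

lemma projection_in_image: "(M ** mp_inverse M) *v x \<in> mat_image M"
  by (metis mat_image_def matrix_vector_mul_assoc rangeI)

lemma orth_compl_orth_compl_mat_image:
  "orth_compl (orth_compl (mat_image M)) = mat_image M"
proof (intro equalityI subsetI)
  fix x assume x: "x \<in> orth_compl (orth_compl (mat_image M))"
  let ?p = "(M ** mp_inverse M) *v x"
  have d: "x - ?p \<in> orth_compl (mat_image M)"
    by (rule diff_projection_in_orth_compl)
  \<comment> \<open>The residual \<open>x - ?p\<close> is orthogonal to \<open>x\<close> and to
    \<open>?p\<close>, hence to itself.\<close>
  have "hinner x (x - ?p) = 0"
    using x d by (auto simp: orth_compl_def)
  moreover have "hinner ?p (x - ?p) = 0"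
    using d projection_in_image[of M x] hinner_commute[of ?p]
    by (simp add: orth_compl_def)
  ultimately have "hinner (x - ?p) (x - ?p) = 0"
    by (simp add: hinner_diff_left)
  then have "x = ?p" by simp
  then show "x \<in> mat_image M"
    using projection_in_image by metis
next
  fix x assume "x \<in> mat_image M"
  then show "x \<in> orth_compl (orth_compl (mat_image M))"
    using hinner_commute[of x] by (simp add: orth_compl_def)
qed

section \<open>Dimension counts\<close>

lemma subspace_mat_image: "vec.subspace (mat_image A)"
  unfolding mat_image_def
  by (rule vec.subspace_image[OF vec.subspace_UNIV])

lemma subspace_mat_ker: "vec.subspace (mat_ker A)"
  by (auto simp: mat_ker_def vec.subspace_def matrix_vector_right_distrib vec.scale)

lemma subspace_orth_compl: "vec.subspace (orth_compl S)"
  by (auto simp: orth_compl_def vec.subspace_def hinner_def distrib_right sum.distrib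
      mult.assoc sum_distrib_left[symmetric])

text \<open>Splitting each vector into residual and projection shows that the two subspaces sum to
  the whole space.\<close>

lemma dim_orth_compl_mat_image_ge:
  fixes M :: "complex^'n^'m"
  shows "CARD('m) \<le> vec.dim (orth_compl (mat_image M)) + vec.dim (mat_image M)"
proof -
  let ?O = "orth_compl (mat_image M)" and ?I = "mat_image M"
  have "z \<in> {x + y |x y. x \<in> ?O \<and> y \<in> ?I}" for z
  proof -
    have "z = (z - (M ** mp_inverse M) *v z) + (M ** mp_inverse M) *v z" by simp
    then show ?thesis
      using diff_projection_in_orth_compl projection_in_image by blast
  qed
  then have "{x + y |x y. x \<in> ?O \<and> y \<in> ?I} = UNIV" by blast
  then show ?thesis
    using vec.dim_sums_Int[OF subspace_orth_compl subspace_mat_image, of "mat_image M" M]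
    by (simp add: card_cart_basis)
qed

text \<open>Each further linear equation lowers the dimension by at most one. The pairing is
  bilinear, without conjugation, to match rows of a matrix acting on vectors.\<close>

lemma dim_le_dim_inter_annihilator:
  fixes S :: "('a::field^'m) set"
  assumes S: "vec.subspace S" and "finite B"
  shows "vec.dim S \<le> vec.dim {x\<in>S. \<forall>b\<in>B. (\<Sum>i\<in>UNIV. b $ i * x $ i) = 0} + card B"
  using \<open>finite B\<close>
proof (induction B rule: finite_induct)
  case empty
  then show ?case by simp
next
  case (insert c B)
  define f where "f b x = (\<Sum>i\<in>UNIV. b $ i * x $ i)" for b x :: "'a^'m"
  let ?K = "\<lambda>B. {x\<in>S. \<forall>b\<in>B. f b x = 0}"
  have f: "f b (x - s *s y) = f b x - s * f b y" for b x y s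
    by (simp add: f_def right_diff_distrib sum_subtractf sum_distrib_left ac_simps)
  have "vec.dim (?K B) \<le> vec.dim (?K (insert c B)) + 1"
  proof (cases "\<exists>y\<in>?K B. f c y \<noteq> 0")
    case True
    then obtain y where y: "y \<in> ?K B" "f c y \<noteq> 0" by blast
    have "x \<in> vec.span (insert y (?K (insert c B)))" if "x \<in> ?K B" for x
    proof -
      \<comment> \<open>The coefficient is chosen so that \<open>f c\<close> vanishes: adjoining the
        single vector \<open>y\<close> recovers all of \<open>?K B\<close>.\<close>
      have "x - (f c x / f c y) *s y \<in> ?K (insert c B)"
        using y that S by (auto simp: f vec.subspace_diff vec.subspace_scale)
      then show ?thesis
        by (meson vec.span_base vec.span_breakdown_eq)
    qed
    then have "vec.dim (?K B) \<le> vec.dim (insert y (?K (insert c B)))"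
      by (intro vec.dim_mono subsetI)
    also have "\<dots> \<le> vec.dim (?K (insert c B)) + 1"
      by (simp add: vec.dim_insert)
    finally show ?thesis .
  next
    case False
    then have "?K B = ?K (insert c B)" by auto
    then show ?thesis by simp
  qed
  with insert show ?case
    by (simp add: f_def)
qed

text \<open>With \<open>B\<close> a basis of the row space, the \<open>rank A\<close> equations
  given by \<open>B\<close> imply those of all rows, so their solutions lie in the kernel.\<close>

lemma dim_kernel_plus_rank_ge:
  fixes A :: "'a::field^'m^'n"
  shows "CARD('m) \<le> vec.dim {x. A *v x = 0} + rank A"
proof -
  obtain B where B: "B \<subseteq> rows A" "rows A \<subseteq> vec.span B" "card B = vec.dim (rows A)"
    using vec.basis_exists by metis
  have "finite B"
    using B(1) by (rule finite_subset) (simp add: rows_def full_SetCompr_eq)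
  have "A *v x = 0" if x: "\<forall>b\<in>B. (\<Sum>i\<in>UNIV. b $ i * x $ i) = 0" for x
  proof -
    have "(\<Sum>i\<in>UNIV. r $ i * x $ i) = 0" if "r \<in> vec.span B" for r
      using that
    proof (induction rule: vec.span_induct_alt)
      case base
      then show ?case by simp
    next
      case (step c b y)
      have "(\<Sum>i\<in>UNIV. (c *s b + y) $ i * x $ i)
          = c * (\<Sum>i\<in>UNIV. b $ i * x $ i) + (\<Sum>i\<in>UNIV. y $ i * x $ i)"
        by (simp add: distrib_right sum.distrib sum_distrib_left mult.assoc)
      then show ?case using step x by simp
    qed
    moreover have "row i A \<in> vec.span B" for i
      using B(2) by (auto simp: rows_def)
    ultimately show ?thesis
      by (auto simp: vec_eq_iff matrix_vector_mult_def row_def)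
  qed
  then have "vec.dim {x\<in>UNIV. \<forall>b\<in>B. (\<Sum>i\<in>UNIV. b $ i * x $ i) = 0} \<le> vec.dim {x. A *v x = 0}"
    by (intro vec.dim_subset) auto
  then show ?thesis
    using dim_le_dim_inter_annihilator[OF vec.subspace_UNIV \<open>finite B\<close>] B(3)
    by (simp add: row_rank_def_gen card_cart_basis)
qed

lemma dim_image_outer_inverse_le_rank:
  fixes A :: "complex^'m^'n"
  assumes "M ** A ** M = M"
  shows "vec.dim (mat_image M) \<le> rank A"
proof -
  have "mat_image M \<inter> mat_ker A \<subseteq> {0}"
  proof
    fix x assume x: "x \<in> mat_image M \<inter> mat_ker A"
    then obtain z where "x = M *v z" by (auto simp: mat_image_def)
    then have "x = M *v (A *v x)"
      using assms by (simp add: matrix_vector_mul_assoc matrix_mul_assoc)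
    then show "x \<in> {0}" using x by (simp add: mat_ker_def)
  qed
  then have "vec.dim (mat_image M \<inter> mat_ker A) = 0"
    by simp
  \<comment> \<open>The sum of the two subspaces is direct inside a space of dimension
    \<open>CARD('m)\<close>; rank-nullity then cancels the kernel.\<close>
  then have "vec.dim (mat_image M) + vec.dim (mat_ker A) \<le> CARD('m)"
    using vec.dim_sums_Int[OF subspace_mat_image subspace_mat_ker, of M A]
      vec.dim_subset_UNIV[of "{x + y |x y. x \<in> mat_image M \<and> y \<in> mat_ker A}"]
    unfolding vec.dimension_def card_cart_basis by linarith
  then show ?thesis
    using dim_kernel_plus_rank_ge[of A] by (simp add: mat_ker_def)
qed

theorem mainTheorem1:
  fixes A :: "complex^'m^'n"
    and X :: "complex^'p^'n"
    and Y :: "complex^'q^'m"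
    and M :: "complex^'n^'m"
    and Xhat :: "(complex^'n) set"
    and Yhat :: "(complex^'m) set"
  assumes M: "M = mp_inverse A - mp_inverse A ** X **
                mp_inverse (conj_transpose Y ** mp_inverse A ** X) **
                conj_transpose Y ** mp_inverse A"
    and Xhat: "Xhat = mat_ker M"
    and Yhat: "Yhat = orth_compl (mat_image M)"
  shows "is_outer_inverse_with A (orth_compl Yhat) Xhat M
       \<and> M = outer_inverse_with A (orth_compl Yhat) Xhat
       \<and> vec.dim Yhat + rank A \<ge> CARD('m)"
proof -
  have MAM: "M ** A ** M = M"
    \<comment> \<open>Both premises are the second Penrose equation, for \<open>A\<close> and for
      \<open>conj_transpose Y ** mp_inverse A ** X\<close>.\<close>
    unfolding M by (intro outer_inverse_deflation outer_mp_inverse)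
  have "is_outer_inverse_with A (orth_compl Yhat) Xhat M"
    using MAM by (simp add: is_outer_inverse_with_def is_outer_inverse_def Xhat Yhat
        orth_compl_orth_compl_mat_image)
  moreover from this have "M = outer_inverse_with A (orth_compl Yhat) Xhat"
    by (simp add: outer_inverse_with_eq)
  \<comment> \<open>\<open>Yhat\<close> and the image of \<open>M\<close> have total dimension at
    least \<open>CARD('m)\<close>, and the image contributes at most \<open>rank A\<close>.\<close>
  moreover have "vec.dim Yhat + rank A \<ge> CARD('m)"
    using dim_orth_compl_mat_image_ge[of M] dim_image_outer_inverse_le_rank[OF MAM]
    by (simp add: Yhat)
  ultimately show ?thesis by blast
qed

end
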